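(* Let $\boldsymbol{s}$ be a centered isotropic sub-Gaussian random vector in $\mathbb{R}^d$ and let $y$ be a sub-Gaussian random variable (defined jointly with $\boldsymbol{s}$) such that $$ \mathbb{E}[y \mid \boldsymbol{s}] = g(\langle\boldsymbol{s},\boldsymbol{z}_0\rangle) $$ where $\boldsymbol{z}_0\in\mathbb{R}^d\setminus\{\boldsymbol{0}\}$ and $g\colon\mathbb{R}\to\mathbb{R}$ is a measurable function. Set $T := \operatorname{span}\{\boldsymbol{z}_0\}$. Then $\boldsymbol{z}^\natural := \mu\boldsymbol{z}_0\in T$ with $$ \mu := \frac{1}{\|\boldsymbol{z}_0\|_2^2}\,\mathbb{E}[g(\langle\boldsymbol{s},\boldsymbol{z}_0\rangle)\langle\boldsymbol{s},\boldsymbol{z}_0\rangle] $$ minimizes the mismatch covariance $\rho$ on $T$, and we have $$ \rho(\boldsymbol{z}^\natural) = \big\|\mathbb{E}[g(\langle\boldsymbol{s},\boldsymbol{z}_0\rangle)\,\boldsymbol{P}_{\boldsymbol{z}_0}^\perp\boldsymbol{s}]\big\|_2 . $$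
   Context: A real random variable $v$ is sub-Gaussian if $\|v\|_{\psi_2} := \sup_{q\ge 1} q^{-1/2}(\mathbb{E}|v|^q)^{1/q}<\infty$; a random vector $\boldsymbol{v}$ in $\mathbb{R}^d$ is sub-Gaussian if $\sup_{\boldsymbol{u}\in\mathbb{S}^{d-1}}\|\langle\boldsymbol{v},\boldsymbol{u}\rangle\|_{\psi_2}<\infty$, centered if $\mathbb{E}[\boldsymbol{v}]=\boldsymbol{0}$, and isotropic if $\mathbb{E}[\boldsymbol{v}\boldsymbol{v}^{\mathsf T}]=\boldsymbol{I}_d$. The mismatch covariance of $\boldsymbol{z}\in\mathbb{R}^d$ is $\rho(\boldsymbol{z}) := \|\mathbb{E}[(y-\langle\boldsymbol{s},\boldsymbol{z}\rangle)\boldsymbol{s}]\|_2$. $\boldsymbol{P}_{\boldsymbol{z}_0}^\perp := \boldsymbol{I}_d-\boldsymbol{P}_{\boldsymbol{z}_0}$, where $\boldsymbol{P}_{\boldsymbol{z}_0}$ is the orthogonal projection onto $\operatorname{span}\{\boldsymbol{z}_0\}$. *)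

theory Defs
  imports "HOL-Probability.Probability"
begin

(* (E|v|^q)^(1/q) in [0, \<infinity>], so that an infinite moment is not confused with the
   value 0 that the Bochner integral gives to non-integrable functions. *)
definition Lq_norm :: "'a measure \<Rightarrow> real \<Rightarrow> ('a \<Rightarrow> real) \<Rightarrow> ennreal" where
  "Lq_norm M q v =
     (let m = (\<integral>\<^sup>+ w. ennreal (\<bar>v w\<bar> powr q) \<partial>M)
      in if m = \<top> then \<top> else ennreal (enn2real m powr (1 / q)))"

definition psi2_norm :: "'a measure \<Rightarrow> ('a \<Rightarrow> real) \<Rightarrow> ennreal" where
  "psi2_norm M v = (SUP q\<in>{1..}. ennreal (q powr (- 1 / 2)) * Lq_norm M q v)"

definition sub_gaussian :: "'a measure \<Rightarrow> ('a \<Rightarrow> real) \<Rightarrow> bool" where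
  "sub_gaussian M v \<longleftrightarrow> v \<in> borel_measurable M \<and> psi2_norm M v < \<top>"

definition sub_gaussian_vec :: "'a measure \<Rightarrow> ('a \<Rightarrow> real ^ 'd) \<Rightarrow> bool" where
  "sub_gaussian_vec M v \<longleftrightarrow>
     v \<in> borel_measurable M \<and> (SUP u\<in>sphere 0 1. psi2_norm M (\<lambda>w. v w \<bullet> u)) < \<top>"

definition centered :: "'a measure \<Rightarrow> ('a \<Rightarrow> real ^ 'd) \<Rightarrow> bool" where
  "centered M v \<longleftrightarrow> integrable M v \<and> (\<integral>w. v w \<partial>M) = 0"

definition isotropic :: "'a measure \<Rightarrow> ('a \<Rightarrow> real ^ 'd) \<Rightarrow> bool" where
  "isotropic M v \<longleftrightarrow> (\<integral>w. (\<chi> i j. v w $ i * v w $ j) \<partial>M) = (mat 1 :: real ^ 'd ^ 'd)"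

definition mismatch_cov ::
    "'a measure \<Rightarrow> ('a \<Rightarrow> real ^ 'd) \<Rightarrow> ('a \<Rightarrow> real) \<Rightarrow> real ^ 'd \<Rightarrow> real" where
  "mismatch_cov M s y z = norm (\<integral>w. (y w - s w \<bullet> z) *\<^sub>R s w \<partial>M)"

definition orth_proj :: "(real ^ 'd) set \<Rightarrow> real ^ 'd \<Rightarrow> real ^ 'd" where
  "orth_proj V x = (THE p. p \<in> V \<and> (\<forall>u\<in>V. orthogonal (x - p) u))"

definition orth_proj_perp :: "(real ^ 'd) set \<Rightarrow> real ^ 'd \<Rightarrow> real ^ 'd" where
  "orth_proj_perp V x = x - orth_proj V x"

lemma orth_proj_ex1:
  fixes V :: "(real ^ 'd) set"
  assumes "subspace V"
  shows "\<exists>!p. p \<in> V \<and> (\<forall>u\<in>V. orthogonal (x - p) u)"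
proof -
  have V: "span V = V" using assms by (simp add: span_eq_iff)
  obtain p r where p: "p \<in> V" "\<And>u. u \<in> V \<Longrightarrow> orthogonal r u" "x = p + r"
    using orthogonal_subspace_decomp_exists[of V x] unfolding V by metis
  show ?thesis
  proof (rule ex1I[of _ p])
    show "p \<in> V \<and> (\<forall>u\<in>V. orthogonal (x - p) u)" using p by auto
  next
    fix q assume q: "q \<in> V \<and> (\<forall>u\<in>V. orthogonal (x - q) u)"
    have "q - p \<in> V" using q p assms by (simp add: subspace_diff)
    then have "(x - p) \<bullet> (q - p) = 0" "(x - q) \<bullet> (q - p) = 0"
      using q p by (auto simp: orthogonal_def)
    then have "((x - p) - (x - q)) \<bullet> (q - p) = 0" by (simp only: inner_diff_left)
    then show "q = p" by simp
  qed
qed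

end

theory Submission
  imports Defs
begin

text \<open>
  Write \<open>h = E[g(\<langle>s, z0\<rangle>) s]\<close>. Two identities determine the mismatch covariance completely.
  Isotropy gives \<open>E[\<langle>s, z\<rangle> s] = z\<close> for every vector \<open>z\<close> (\<open>isotropic_integral\<close>). As \<open>s\<close> is
  measurable for the \<open>\<sigma>\<close>-algebra that it generates, the tower property replaces \<open>y\<close> by its
  conditional expectation in every product with \<open>\<langle>s, u\<rangle>\<close>, so that \<open>E[y s] = h\<close>
  (\<open>integral_scaleR_cond_exp\<close>). Consequently \<open>\<rho>(z) = \<parallel>h - z\<parallel>\<close>: the mismatch covariance is a
  Euclidean distance, and its minimizer on a line is the orthogonal projection of \<open>h\<close> onto that
  line. The coefficient of that projection is \<open>\<langle>h, z0\<rangle> / \<parallel>z0\<parallel>\<^sup>2 = \<mu>\<close>, and the minimal value is the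
  norm of \<open>P\<^sup>\<bottom> h\<close>. Since \<open>P\<^sup>\<bottom>\<close> is linear, it can be moved inside the expectation.

  Integrability of \<open>y s\<close> comes from finite second moments: the \<open>q = 2\<close> term of the sub-Gaussian
  norm for \<open>y\<close>, isotropy for \<open>s\<close>.
\<close>

lemma sub_gaussian_square_integrable:
  assumes "sub_gaussian M v"
  shows "integrable M (\<lambda>w. (v w)\<^sup>2)"
proof -
  have meas: "v \<in> borel_measurable M" and fin: "psi2_norm M v < \<top>"
    using assms by (auto simp: sub_gaussian_def)
  have "ennreal (2 powr (- 1 / 2)) * Lq_norm M 2 v \<le> psi2_norm M v"
    unfolding psi2_norm_def by (rule SUP_upper) simp
  with fin have "ennreal (2 powr (- 1 / 2)) * Lq_norm M 2 v < \<top>"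
    by (rule le_less_trans[rotated])
  then have "Lq_norm M 2 v \<noteq> \<top>"
    by (auto simp: ennreal_mult_top)
  then have "(\<integral>\<^sup>+ w. ennreal (\<bar>v w\<bar> powr 2) \<partial>M) \<noteq> \<top>"
    by (auto simp: Lq_norm_def Let_def)
  then have "(\<integral>\<^sup>+ w. ennreal ((v w)\<^sup>2) \<partial>M) < \<top>"
    by (simp add: powr_numeral less_top)
  then show ?thesis
    using meas by (intro integrableI_bounded) auto
qed

lemma integrable_mult_of_squares:
  fixes f g :: "'a \<Rightarrow> real"
  assumes "f \<in> borel_measurable M" "g \<in> borel_measurable M"
    and "integrable M (\<lambda>w. (f w)\<^sup>2)" "integrable M (\<lambda>w. (g w)\<^sup>2)"
  shows "integrable M (\<lambda>w. f w * g w)"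
proof (rule Bochner_Integration.integrable_bound)
  show "integrable M (\<lambda>w. (f w)\<^sup>2 + (g w)\<^sup>2)"
    using assms by simp
  have "\<bar>a * b\<bar> \<le> a\<^sup>2 + b\<^sup>2" for a b :: real
  proof -
    have "0 \<le> (\<bar>a\<bar> - \<bar>b\<bar>)\<^sup>2" by simp
    then have "2 * (\<bar>a\<bar> * \<bar>b\<bar>) \<le> a\<^sup>2 + b\<^sup>2" by (simp add: power2_diff)
    moreover have "0 \<le> \<bar>a\<bar> * \<bar>b\<bar>" by simp
    ultimately show ?thesis unfolding abs_mult by linarith
  qed
  then show "AE w in M. norm (f w * g w) \<le> norm ((f w)\<^sup>2 + (g w)\<^sup>2)"
    by auto
qed (use assms in auto)

lemma integrable_if_inner_integrable:
  fixes f :: "'a \<Rightarrow> 'b::euclidean_space"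
  assumes "\<And>u. integrable M (\<lambda>w. f w \<bullet> u)"
  shows "integrable M f"
proof -
  have "integrable M (\<lambda>w. \<Sum>b\<in>Basis. (f w \<bullet> b) *\<^sub>R b)"
    using assms by (intro Bochner_Integration.integrable_sum integrable_scaleR_left)
  then show ?thesis
    by (simp add: euclidean_representation)
qed

text \<open>
  The matrix \<open>v v\<^sup>T\<close> applied to \<open>z\<close> is \<open>\<langle>v, z\<rangle> v\<close>. Integrability is part of the conclusion because
  the Bochner integral of a non-integrable function is \<open>0\<close>, which is not the identity matrix.
\<close>

lemma isotropic_integral:
  assumes "isotropic M v"
  shows "integrable M (\<lambda>w. (v w \<bullet> z) *\<^sub>R v w)"
    and "(\<integral>w. (v w \<bullet> z) *\<^sub>R v w \<partial>M) = z"
proof -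
  let ?A = "\<lambda>w. (\<chi> i j. v w $ i * v w $ j)"
  have id: "(\<integral>w. ?A w \<partial>M) = mat 1"
    using assms by (simp add: isotropic_def)
  have "(mat 1 :: real ^ 'b ^ 'b) \<noteq> 0"
    by (auto simp: vec_eq_iff mat_def)
  with id have int: "integrable M ?A"
    using not_integrable_integral_eq by fastforce
  have "linear (\<lambda>A :: real ^ 'b ^ 'b. A *v z)"
    by (intro linearI) (simp_all only: matrix_vector_mult_add_rdistrib scaleR_matrix_vector_assoc)
  then have bl: "bounded_linear (\<lambda>A :: real ^ 'b ^ 'b. A *v z)"
    by (simp add: linear_conv_bounded_linear)
  have eq: "?A w *v z = (v w \<bullet> z) *\<^sub>R v w" for w
    by (auto simp: vec_eq_iff matrix_vector_mult_def inner_vec_def sum_distrib_left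
        sum_distrib_right mult_ac)
  show "integrable M (\<lambda>w. (v w \<bullet> z) *\<^sub>R v w)"
    using integrable_bounded_linear[OF bl int] by (simp add: eq)
  show "(\<integral>w. (v w \<bullet> z) *\<^sub>R v w \<partial>M) = z"
    using integral_bounded_linear[OF bl int] by (simp add: eq id)
qed

lemma isotropic_square_integrable:
  assumes "isotropic M v"
  shows "integrable M (\<lambda>w. (v w \<bullet> u)\<^sup>2)"
  using integrable_inner_left[OF isotropic_integral(1)[OF assms], of u u]
  by (simp add: power2_eq_square)

text \<open>
  The tower property for vector-valued weights, obtained by testing against each direction.
\<close>

lemma (in prob_space) integral_scaleR_cond_exp:
  fixes s :: "'a \<Rightarrow> 'b::euclidean_space"
  assumes s [measurable]: "s \<in> borel_measurable M"
    and y [measurable]: "y \<in> borel_measurable M"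
    and G [measurable]: "G \<in> borel_measurable M"
    and cond: "AE w in M. real_cond_exp M (vimage_algebra (space M) s borel) y w = G w"
    and int: "integrable M (\<lambda>w. y w *\<^sub>R s w)"
  shows "integrable M (\<lambda>w. G w *\<^sub>R s w)"
    and "(\<integral>w. G w *\<^sub>R s w \<partial>M) = (\<integral>w. y w *\<^sub>R s w \<partial>M)"
proof -
  let ?F = "vimage_algebra (space M) s borel"
  have sub: "subalgebra M ?F"
    unfolding subalgebra_def
    by (auto simp: sets_vimage_algebra2 intro: measurable_sets[OF s])
  interpret finite_measure_subalgebra M ?F
    by unfold_locales (rule sub)
  have sF: "s \<in> measurable ?F borel"
    by (rule measurable_vimage_algebra1) simp
  have tower: "integrable M (\<lambda>w. (G w *\<^sub>R s w) \<bullet> u)"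
    "(\<integral>w. (G w *\<^sub>R s w) \<bullet> u \<partial>M) = (\<integral>w. (y w *\<^sub>R s w) \<bullet> u \<partial>M)" for u
  proof -
    have [measurable]: "(\<lambda>w. s w \<bullet> u) \<in> borel_measurable ?F"
      using sF by measurable
    have "integrable M (\<lambda>w. (y w *\<^sub>R s w) \<bullet> u)"
      by (rule integrable_inner_left[OF int])
    then have prod: "integrable M (\<lambda>w. (s w \<bullet> u) * y w)"
      by (simp add: mult.commute)
    note ce = real_cond_exp_intg[OF prod]
    have ae: "AE w in M. (s w \<bullet> u) * real_cond_exp M ?F y w = (G w *\<^sub>R s w) \<bullet> u"
      using cond by eventually_elim simp
    have "integrable M (\<lambda>w. (s w \<bullet> u) * real_cond_exp M ?F y w)"
      by (rule ce(1)) measurable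
    then show "integrable M (\<lambda>w. (G w *\<^sub>R s w) \<bullet> u)"
      by (rule integrable_cong_AE_imp) (use ae in auto)
    have "(\<integral>w. (s w \<bullet> u) * real_cond_exp M ?F y w \<partial>M) = (\<integral>w. (s w \<bullet> u) * y w \<partial>M)"
      by (rule ce(2)) measurable
    moreover have "(\<integral>w. (s w \<bullet> u) * real_cond_exp M ?F y w \<partial>M) = (\<integral>w. (G w *\<^sub>R s w) \<bullet> u \<partial>M)"
      by (rule integral_cong_AE) (use ae in auto)
    ultimately show "(\<integral>w. (G w *\<^sub>R s w) \<bullet> u \<partial>M) = (\<integral>w. (y w *\<^sub>R s w) \<bullet> u \<partial>M)"
      by (simp add: mult.commute)
  qed
  show GI: "integrable M (\<lambda>w. G w *\<^sub>R s w)"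
    by (rule integrable_if_inner_integrable) (rule tower(1))
  show "(\<integral>w. G w *\<^sub>R s w \<partial>M) = (\<integral>w. y w *\<^sub>R s w \<partial>M)"
  proof (rule euclidean_eqI)
    fix b :: 'b
    show "(\<integral>w. G w *\<^sub>R s w \<partial>M) \<bullet> b = (\<integral>w. y w *\<^sub>R s w \<partial>M) \<bullet> b"
      using tower(2)[of b] unfolding integral_inner_left[OF GI] integral_inner_left[OF int] .
  qed
qed

lemma orth_proj_line:
  fixes a :: "real ^ 'd"
  assumes "a \<noteq> 0"
  shows "orth_proj (span {a}) x = (x \<bullet> a / (norm a)\<^sup>2) *\<^sub>R a"
  unfolding orth_proj_def
proof (rule the1_equality[OF orth_proj_ex1])
  have "(x - (x \<bullet> a / (norm a)\<^sup>2) *\<^sub>R a) \<bullet> a = 0"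
    using assms by (simp add: inner_diff_left dot_square_norm)
  then have "orthogonal (x - (x \<bullet> a / (norm a)\<^sup>2) *\<^sub>R a) u" if "u \<in> span {a}" for u
    using that unfolding span_singleton orthogonal_def by auto
  then show "(x \<bullet> a / (norm a)\<^sup>2) *\<^sub>R a \<in> span {a} \<and>
      (\<forall>u\<in>span {a}. orthogonal (x - (x \<bullet> a / (norm a)\<^sup>2) *\<^sub>R a) u)"
    by (auto simp: span_singleton)
qed (rule subspace_span)

lemma bounded_linear_orth_proj_perp_line:
  fixes a :: "real ^ 'd"
  assumes "a \<noteq> 0"
  shows "bounded_linear (orth_proj_perp (span {a}))"
proof -
  have "orth_proj_perp (span {a}) = (\<lambda>x. x - ((x \<bullet> a) / (norm a)\<^sup>2) *\<^sub>R a)"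
    by (simp add: fun_eq_iff orth_proj_perp_def orth_proj_line[OF assms])
  moreover have "bounded_linear (\<lambda>x. x - ((x \<bullet> a) / (norm a)\<^sup>2) *\<^sub>R a)"
    by (intro bounded_linear_sub bounded_linear_ident
        bounded_linear_scaleR_const bounded_linear_compose[OF bounded_linear_divide]
        bounded_linear_inner_left)
  ultimately show ?thesis
    by simp
qed

text \<open>
  Pythagoras: \<open>x - p\<close> is orthogonal to \<open>p - u\<close> for the projection \<open>p\<close> of \<open>x\<close>.
\<close>

lemma norm_diff_orth_proj_le:
  fixes x :: "real ^ 'd"
  assumes "subspace V" "u \<in> V"
  shows "norm (x - orth_proj V x) \<le> norm (x - u)"
proof -
  let ?p = "orth_proj V x"
  have p: "?p \<in> V" "\<forall>u\<in>V. orthogonal (x - ?p) u"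
    using theI'[OF orth_proj_ex1[OF assms(1), of x]] unfolding orth_proj_def by blast+
  with assms have "orthogonal (x - ?p) (?p - u)"
    by (simp add: subspace_diff)
  from norm_add_Pythagorean[OF this]
  have "(norm (x - ?p))\<^sup>2 \<le> (norm (x - u))\<^sup>2"
    by simp
  then show ?thesis
    by (rule power2_le_imp_le) simp
qed

theorem proposition3p9:
  fixes M :: "'a measure"
    and s :: "'a \<Rightarrow> real ^ 'd"
    and y :: "'a \<Rightarrow> real"
    and z0 z_nat :: "real ^ 'd"
    and g :: "real \<Rightarrow> real"
    and T :: "(real ^ 'd) set"
    and mu :: real
  assumes "prob_space M"
    and "sub_gaussian_vec M s"
    and "centered M s"
    and "isotropic M s"
    and "sub_gaussian M y"
    and "z0 \<noteq> 0"
    and "g \<in> borel_measurable borel"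
    and "AE w in M. real_cond_exp M (vimage_algebra (space M) s borel) y w = g (s w \<bullet> z0)"
    and "T = span {z0}"
    and "mu = 1 / (norm z0)\<^sup>2 * (\<integral>w. g (s w \<bullet> z0) * (s w \<bullet> z0) \<partial>M)"
    and "z_nat = mu *\<^sub>R z0"
  shows "is_arg_min (mismatch_cov M s y) (\<lambda>z. z \<in> T) z_nat
       \<and> mismatch_cov M s y z_nat
           = norm (\<integral>w. g (s w \<bullet> z0) *\<^sub>R orth_proj_perp (span {z0}) (s w) \<partial>M)"
proof -
  interpret prob_space M by fact
  have [measurable]: "s \<in> borel_measurable M" "y \<in> borel_measurable M" "g \<in> borel_measurable borel"
    using assms by (auto simp: sub_gaussian_vec_def sub_gaussian_def)
  have ys: "integrable M (\<lambda>w. y w *\<^sub>R s w)"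
  proof (rule integrable_if_inner_integrable)
    fix u
    show "integrable M (\<lambda>w. (y w *\<^sub>R s w) \<bullet> u)"
      unfolding inner_scaleR_left
      by (rule integrable_mult_of_squares)
        (use sub_gaussian_square_integrable[OF assms(5)] isotropic_square_integrable[OF assms(4)]
          in simp_all)
  qed
  define h where "h = (\<integral>w. g (s w \<bullet> z0) *\<^sub>R s w \<partial>M)"
  have Gs: "integrable M (\<lambda>w. g (s w \<bullet> z0) *\<^sub>R s w)"
    by (rule integral_scaleR_cond_exp(1)[OF _ _ _ assms(8) ys]) auto
  have h: "h = (\<integral>w. y w *\<^sub>R s w \<partial>M)"
    unfolding h_def by (rule integral_scaleR_cond_exp(2)[OF _ _ _ assms(8) ys]) auto
  have rho: "mismatch_cov M s y z = norm (h - z)" for z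
    using ys isotropic_integral[OF assms(4), of z]
    by (simp add: mismatch_cov_def h scaleR_diff_left)
  have "(\<integral>w. g (s w \<bullet> z0) * (s w \<bullet> z0) \<partial>M) = h \<bullet> z0"
    using integral_inner_left[OF Gs, of z0] by (simp add: h_def)
  then have z_nat: "z_nat = orth_proj (span {z0}) h"
    using assms by (simp add: orth_proj_line)
  have "is_arg_min (mismatch_cov M s y) (\<lambda>z. z \<in> T) z_nat"
    unfolding is_arg_min_linorder
  proof (intro conjI allI impI)
    show "z_nat \<in> T"
      using assms by (auto simp: span_singleton)
    show "mismatch_cov M s y z_nat \<le> mismatch_cov M s y z" if "z \<in> T" for z
      using that norm_diff_orth_proj_le[of "span {z0}" z h]
      by (simp add: rho z_nat \<open>T = span {z0}\<close>)
  qed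
  moreover have "mismatch_cov M s y z_nat
      = norm (\<integral>w. g (s w \<bullet> z0) *\<^sub>R orth_proj_perp (span {z0}) (s w) \<partial>M)"
  proof -
    note bl = bounded_linear_orth_proj_perp_line[OF \<open>z0 \<noteq> 0\<close>]
    have "(\<integral>w. g (s w \<bullet> z0) *\<^sub>R orth_proj_perp (span {z0}) (s w) \<partial>M)
        = orth_proj_perp (span {z0}) h"
      using integral_bounded_linear[OF bl Gs]
      by (simp add: h_def linear_cmul[OF bounded_linear.linear[OF bl]])
    then show ?thesis
      by (simp add: rho z_nat orth_proj_perp_def)
  qed
  ultimately show ?thesis ..
qed

end
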